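(* Let $N\ge2$, let $\alpha>N-\frac12$, and let $0\le a_1\le a_2\le\cdots\le a_N$ be a given initial condition. For $t\ge0$ let $$(y_1(t),\dots,y_{2N}(t))=\big(-\sqrt{2a_N},-\sqrt{2a_{N-1}},\dots,-\sqrt{2a_1},\sqrt{2a_1},\dots,\sqrt{2a_{N-1}},\sqrt{2a_N}\big)\boxplus_{2N}\sqrt t\,(z_{1,2N}^{(H)},\dots,z_{2N,2N}^{(H)}).$$ Let $x_1(t)\le\dots\le x_N(t)$ be the Laguerre limiting processes with parameter $\alpha$ and initial condition $(a_1,\dots,a_N)$. Then for all $t\ge0$ $$(x_1(t),\dots,x_N(t))=\tfrac12\big(y_{N+1}(t)^2,\dots,y_{2N}(t)^2\big)\boxplus_N t\,\big(z_{1,N}^{(\alpha-N+\frac12)},\dots,z_{N,N}^{(\alpha-N+\frac12)}\big).$$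
   Context: $e_k$ denotes the $k$th elementary symmetric polynomial in $N$ variables, $e_0=1$. For $M\ge1$, the finite free convolution $(c_1,\dots,c_M)=(a_1,\dots,a_M)\boxplus_M(b_1,\dots,b_M)$ of two $M$-tuples of reals is the $M$-tuple of reals $c_1\le\dots\le c_M$ determined by $e_k(c_1,\dots,c_M)=\sum_{i+j=k}\frac{(M-i)!(M-j)!}{M!(M-k)!}e_i(a_1,\dots,a_M)e_j(b_1,\dots,b_M)$, $k=1,\dots,M$ (real-rootedness is known). $z_{1,M}^{(H)}<\dots<z_{M,M}^{(H)}$ are the zeros of the $M$th probabilist's Hermite polynomial ($H_0=1$, $H_1=x$, $H_{n+1}=xH_n-nH_{n-1}$). For $\alpha'>0$, $0<z_{1,N}^{(\alpha')}<\dots<z_{N,N}^{(\alpha')}$ are the zeros of the $N$th monic Laguerre polynomial $L_N^{(\alpha')}$, where $\{L_n^{(\alpha')}\}_{n\ge0}$ are the monic polynomials orthogonal with respect to the weight $x^{\alpha'-1}e^{-x}$ on $(0,\infty)$. Laguerre limiting processes: for $\alpha>0$ and $0\le a_1\le\dots\le a_N$, define $g_0\equiv1$ and $g_k(t)=e_k(a_1,\dots,a_N)+(N-k+1)(N-k+\alpha)\int_0^tg_{k-1}(u)\,du$ for $k=1,\dots,N$. The Laguerre limiting processes with parameter $\alpha$ and initial condition $(a_1,\dots,a_N)$ are $x_1(t)\le\dots\le x_N(t)$ determined by $e_k(x_1(t),\dots,x_N(t))=g_k(t)$, $k=1,\dots,N$. They are the limits, as $\beta\to\infty$, of the solution of $d\lambda_i=\frac{2}{\sqrt\beta}\sqrt{\lambda_i}\,db_i+\alpha\,dt+\sum_{j\ne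 i}\frac{2\lambda_i}{\lambda_i-\lambda_j}dt$, $\lambda_i(0)=a_i$ (in particular they are real and nonnegative). *)

theory Defs
  imports "HOL-Analysis.Analysis" "HOL-Computational_Algebra.Polynomial"
begin

text \<open>
  A tuple \<open>(c\<^sub>1, \<dots>, c\<^sub>M)\<close> of reals is a list of length \<open>M\<close>; the entry \<open>c\<^sub>i\<close> is \<open>c ! (i - 1)\<close>.
\<close>

definition elem_sym :: "nat \<Rightarrow> real list \<Rightarrow> real" where
  "elem_sym k xs = (\<Sum>I | I \<subseteq> {..<length xs} \<and> card I = k. \<Prod>i\<in>I. xs ! i)"

text \<open>
  \<open>is_finite_free_conv M a b c\<close> says \<open>c = a \<boxplus>\<^sub>M b\<close>. There is at most one such \<open>c\<close>, since a
  sorted tuple is determined by its elementary symmetric polynomials, and one exists because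
  the polynomial with the prescribed coefficients is known to be real-rooted.
\<close>

definition is_finite_free_conv :: "nat \<Rightarrow> real list \<Rightarrow> real list \<Rightarrow> real list \<Rightarrow> bool" where
  "is_finite_free_conv M a b c \<longleftrightarrow>
     length a = M \<and> length b = M \<and> length c = M \<and> sorted c \<and>
     (\<forall>k\<in>{1..M}. elem_sym k c =
        (\<Sum>i\<le>k. (fact (M - i) * fact (M - (k - i))) / (fact M * fact (M - k))
                 * elem_sym i a * elem_sym (k - i) b))"

fun hermite :: "nat \<Rightarrow> real poly" where
  "hermite 0 = 1"
| "hermite (Suc 0) = [:0, 1:]"
| "hermite (Suc (Suc n)) = [:0, 1:] * hermite (Suc n) - smult (real (Suc n)) (hermite n)"

text \<open>Parameter \<open>\<alpha>\<close> belongs to the weight \<open>x powr (\<alpha> - 1) * exp (- x)\<close>, not \<open>x powr \<alpha> * exp (- x)\<close>.\<close>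

definition is_monic_laguerre :: "real \<Rightarrow> (nat \<Rightarrow> real poly) \<Rightarrow> bool" where
  "is_monic_laguerre \<alpha> L \<longleftrightarrow>
     (\<forall>n. degree (L n) = n \<and> lead_coeff (L n) = 1) \<and>
     (\<forall>m n. m \<noteq> n \<longrightarrow>
        ((\<lambda>x. poly (L m) x * poly (L n) x * (x powr (\<alpha> - 1) * exp (- x))) has_integral 0) {0<..})"

definition laguerre :: "real \<Rightarrow> nat \<Rightarrow> real poly" where
  "laguerre \<alpha> = (THE L. is_monic_laguerre \<alpha> L)"

text \<open>
  The zeros in increasing order, without multiplicity: all zeros of the Hermite and Laguerre
  polynomials are real and simple, so that the list has as many entries as the degree.
\<close>

definition poly_zeros :: "real poly \<Rightarrow> real list" where
  "poly_zeros p = sorted_list_of_set {x. poly p x = 0}"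

primrec laguerre_coeff :: "real \<Rightarrow> real list \<Rightarrow> nat \<Rightarrow> real \<Rightarrow> real" where
  "laguerre_coeff \<alpha> a 0 = (\<lambda>t. 1)"
| "laguerre_coeff \<alpha> a (Suc k) = (\<lambda>t. elem_sym (Suc k) a
     + (real (length a) - real (Suc k) + 1) * (real (length a) - real (Suc k) + \<alpha>)
       * integral {0..t} (laguerre_coeff \<alpha> a k))"

definition is_laguerre_limiting :: "real \<Rightarrow> real list \<Rightarrow> (real \<Rightarrow> real list) \<Rightarrow> bool" where
  "is_laguerre_limiting \<alpha> a x \<longleftrightarrow>
     (\<forall>t\<ge>0. length (x t) = length a \<and> sorted (x t) \<and>
       (\<forall>k\<in>{1..length a}. elem_sym k (x t) = laguerre_coeff \<alpha> a k t))"

end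

theory Submission
  imports Defs
begin

text \<open>
  Everything is compared on the level of elementary symmetric polynomials. The tuple \<open>y(t)\<close> has
  vanishing odd elementary symmetric polynomials, so it is symmetric about \<open>0\<close>, and the explicit
  Hermite coefficients turn its even ones into
  \<open>e\<^sub>k(y\<^sup>2/2) = (\<Sum>i\<le>k. e\<^sub>i(a) t\<^bsup>k-i\<^esup> (N-i)!/(N-k)! (N-i-1/2 gchoose k-i))\<close>,
  which is the Laguerre process with parameter \<open>1/2\<close>. For general \<open>\<alpha>\<close> the upper argument of the
  generalised binomial coefficient is \<open>N-i-1+\<alpha>\<close>, while the \<open>k\<close>th elementary symmetric polynomial of
  the zeros of the Laguerre polynomial with parameter \<open>\<alpha>-N+1/2\<close> is
  \<open>N!/(N-k)! (\<alpha>-1/2 gchoose k)\<close>. Since \<open>(N-i-1/2) + (\<alpha>-1/2) = N-i-1+\<alpha>\<close>, the claim is the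
  Chu--Vandermonde identity.
\<close>

subsection \<open>Elementary symmetric polynomials and roots\<close>

text \<open>Encodes a tuple up to order: its coefficients are the elementary symmetric polynomials
  up to sign, and its roots with multiplicity give the multiset back.\<close>

definition root_poly :: "real list \<Rightarrow> real poly" where
  "root_poly xs = (\<Prod>x\<leftarrow>xs. [:- x, 1:])"

lemma root_poly_simps [simp]:
  "root_poly [] = 1"
  "root_poly (x # xs) = [:- x, 1:] * root_poly xs"
  "root_poly (xs @ ys) = root_poly xs * root_poly ys"
  by (simp_all add: root_poly_def)

lemma root_poly_nonzero [simp]: "root_poly xs \<noteq> 0"
  by (induction xs) (auto simp del: mult_pCons_left)

lemma lead_coeff_root_poly [simp]: "lead_coeff (root_poly xs) = 1"
  by (induction xs) (simp_all add: lead_coeff_mult del: mult_pCons_left)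

lemma degree_root_poly [simp]: "degree (root_poly xs) = length xs"
  by (induction xs) (simp_all add: degree_mult_eq del: mult_pCons_left)

lemma root_poly_cong_mset: "mset xs = mset ys \<Longrightarrow> root_poly xs = root_poly ys"
  by (metis mset_map prod_mset_prod_list root_poly_def)

lemma proots_root_poly: "proots (root_poly xs) = mset xs"
  by (induction xs) (simp_all add: proots_mult del: mult_pCons_left)

lemma root_poly_eq_iff: "root_poly xs = root_poly ys \<longleftrightarrow> mset xs = mset ys"
  by (metis proots_root_poly root_poly_cong_mset)

text \<open>Vieta: expand the product of the factors \<open>- x_i + X\<close> over the set
  \<open>I\<close> of indices where the constant is chosen; the remaining factors give
  \<open>X\<close> to the power \<open>length xs - card I\<close>.\<close>

lemma coeff_root_poly:
  assumes "k \<le> length xs"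
  shows "coeff (root_poly xs) (length xs - k) = (- 1) ^ k * elem_sym k xs"
proof -
  let ?n = "length xs"
  have "root_poly xs = (\<Prod>i<?n. [:- (xs ! i):] + monom 1 1)"
    by (simp add: root_poly_def prod.list_conv_set_nth atLeast0LessThan monom_altdef)
  also have "\<dots> = (\<Sum>I\<in>Pow {..<?n}. (\<Prod>i\<in>I. [:- (xs ! i):]) * (\<Prod>i\<in>{..<?n} - I. monom 1 1))"
    by (rule prod_add) simp
  also have "\<dots> = (\<Sum>I\<in>Pow {..<?n}. smult (\<Prod>i\<in>I. - (xs ! i)) (monom 1 (?n - card I)))"
  proof (intro sum.cong refl)
    fix I assume I: "I \<in> Pow {..<?n}"
    have "(\<Prod>i\<in>I. [:- (xs ! i):]) = [:\<Prod>i\<in>I. - (xs ! i):]"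
      by (induction I rule: infinite_finite_induct) (simp_all add: one_pCons)
    moreover have "card ({..<?n} - I) = ?n - card I"
      using I by (subst card_Diff_subset) (auto intro: finite_subset)
    ultimately show "(\<Prod>i\<in>I. [:- (xs ! i):]) * (\<Prod>i\<in>{..<?n} - I. monom 1 1)
        = smult (\<Prod>i\<in>I. - (xs ! i)) (monom 1 (?n - card I))"
      by (simp add: monom_power)
  qed
  finally have "coeff (root_poly xs) (?n - k) =
      (\<Sum>I\<in>Pow {..<?n}. (\<Prod>i\<in>I. - (xs ! i)) * (if ?n - card I = ?n - k then 1 else 0))"
    by (simp add: coeff_sum)
  also have "\<dots> = (\<Sum>I | I \<subseteq> {..<?n} \<and> card I = k. (- 1) ^ k * (\<Prod>i\<in>I. xs ! i))"
  proof (rule sum.mono_neutral_cong_right)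
    show "\<forall>I\<in>Pow {..<?n} - {I. I \<subseteq> {..<?n} \<and> card I = k}.
        (\<Prod>i\<in>I. - (xs ! i)) * (if ?n - card I = ?n - k then 1 else 0) = 0"
    proof
      fix I assume I: "I \<in> Pow {..<?n} - {I. I \<subseteq> {..<?n} \<and> card I = k}"
      \<comment> \<open>Both \<open>card I\<close> and \<open>k\<close> are at most
        \<open>?n\<close>, so the truncated differences agree only if
        \<open>card I = k\<close>.\<close>
      then have "card I \<le> ?n"
        using card_mono[of "{..<?n}" I] by auto
      then show "(\<Prod>i\<in>I. - (xs ! i)) * (if ?n - card I = ?n - k then 1 else 0) = 0"
        using I assms by auto
    qed
  qed (auto simp: prod_uminus)
  also have "\<dots> = (- 1) ^ k * elem_sym k xs"
    by (simp add: elem_sym_def sum_distrib_left)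
  finally show ?thesis .
qed

lemma elem_sym_conv_coeff:
  assumes "k \<le> length xs"
  shows "elem_sym k xs = (- 1) ^ k * coeff (root_poly xs) (length xs - k)"
  using coeff_root_poly[OF assms] by (simp flip: mult.assoc power_add)

lemma elem_sym_0 [simp]: "elem_sym 0 xs = 1"
proof -
  have "{I. I \<subseteq> {..<length xs} \<and> card I = 0} = {{}}"
    by (auto simp: card_eq_0_iff intro: finite_subset)
  then show ?thesis
    by (simp add: elem_sym_def)
qed

lemma elem_sym_map_mult: "elem_sym k (map (\<lambda>x. c * x) xs) = c ^ k * elem_sym k xs"
  unfolding elem_sym_def sum_distrib_left length_map
proof (intro sum.cong refl)
  fix I assume I: "I \<in> {I. I \<subseteq> {..<length xs} \<and> card I = k}"
  then have "(\<Prod>i\<in>I. map (\<lambda>x. c * x) xs ! i) = (\<Prod>i\<in>I. c * xs ! i)"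
    by (intro prod.cong) auto
  then show "(\<Prod>i\<in>I. map (\<lambda>x. c * x) xs ! i) = c ^ k * (\<Prod>i\<in>I. xs ! i)"
    using I by (simp add: prod.distrib)
qed

section \<open>Tuples symmetric about the origin\<close>

lemma coeff_pcompose_X2:
  fixes p :: "'a::comm_semiring_1 poly"
  shows "coeff (p \<circ>\<^sub>p [:0, 0, 1:]) j = (if even j then coeff p (j div 2) else 0)"
proof (induction p arbitrary: j)
  case (pCons a p)
  have "[:0, 0, 1:] * q = pCons 0 (pCons 0 q)" for q :: "'a poly"
    by simp
  with pCons.IH show ?case
    by (auto simp: pcompose_pCons coeff_pCons split: nat.splits
        simp del: mult_pCons_left mult_pCons_right)
qed simp

text \<open>Pair the factors: \<open>(X + x) * (X - x) = X^2 - x^2\<close>. The reversal only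
  permutes the roots.\<close>

lemma root_poly_symmetric:
  "root_poly (map uminus (rev xs) @ xs) = root_poly (map (\<lambda>v. v\<^sup>2) xs) \<circ>\<^sub>p [:0, 0, 1:]"
proof -
  have "root_poly (map uminus (rev xs)) = root_poly (map uminus xs)"
    by (rule root_poly_cong_mset) simp
  moreover have "root_poly (map uminus xs) * root_poly xs
      = root_poly (map (\<lambda>v. v\<^sup>2) xs) \<circ>\<^sub>p [:0, 0, 1:]"
  proof (induction xs)
    case (Cons x xs)
    have "root_poly (map uminus (x # xs)) * root_poly (x # xs)
        = ([:x, 1:] * [:-x, 1:]) * (root_poly (map uminus xs) * root_poly xs)"
      by (simp add: algebra_simps del: mult_pCons_left mult_pCons_right)
    also have "[:x, 1:] * [:-x, 1:] = [:- (x\<^sup>2), 1:] \<circ>\<^sub>p [:0, 0, 1:]"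
      by (simp add: pcompose_pCons power2_eq_square)
    finally show ?case
      by (simp add: Cons.IH pcompose_mult del: mult_pCons_left mult_pCons_right)
  qed (simp add: pcompose_1)
  ultimately show ?thesis by simp
qed

lemma elem_sym_symmetric:
  assumes "k \<le> 2 * length xs"
  shows "elem_sym k (map uminus (rev xs) @ xs) =
    (if even k then (- 1) ^ (k div 2) * elem_sym (k div 2) (map (\<lambda>v. v\<^sup>2) xs) else 0)"
proof (cases "even k")
  case True
  then obtain m where k: "k = 2 * m" by blast
  have "2 * length xs - 2 * m = 2 * (length xs - m)" by simp
  then show ?thesis
    using assms by (simp add: k elem_sym_conv_coeff root_poly_symmetric coeff_pcompose_X2
        flip: mult_2 mult.assoc power_add del: root_poly_simps)
next
  case False
  moreover have "odd (2 * length xs - k)"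
    using False assms by simp
  ultimately show ?thesis
    using assms by (simp add: elem_sym_conv_coeff root_poly_symmetric coeff_pcompose_X2
        flip: mult_2 del: root_poly_simps)
qed

text \<open>As the length is even, the vanishing odd elementary symmetric polynomials make
  \<open>root_poly ys\<close> an even polynomial. Negation then preserves the multiset of roots, and
  sortedness turns this into the list equality \<open>rev (map uminus ys) = ys\<close>.\<close>

lemma sorted_symmetricI:
  assumes "sorted ys" "length ys = 2 * n" "\<And>k. odd k \<Longrightarrow> k \<le> 2 * n \<Longrightarrow> elem_sym k ys = 0"
  shows "ys = map uminus (rev (drop n ys)) @ drop n ys"
proof -
  have even_pcompose: "(root_poly ys) \<circ>\<^sub>p [:0, -1:] = root_poly ys"
  proof (rule poly_eqI)
    fix j
    have "coeff (root_poly ys) j = 0" if "odd j"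
    proof (cases "j \<le> 2 * n")
      case True
      then have "coeff (root_poly ys) (length ys - (2 * n - j)) = 0"
        using assms that by (subst coeff_root_poly) auto
      then show ?thesis using True assms(2) by simp
    qed (simp add: coeff_eq_0 assms(2))
    then show "coeff (root_poly ys \<circ>\<^sub>p [:0, -1:]) j = coeff (root_poly ys) j"
      by (cases "even j") (simp_all add: coeff_pcompose_linear)
  qed
  have "root_poly (map uminus xs) = smult ((- 1) ^ length xs) (root_poly xs \<circ>\<^sub>p [:0, -1:])" for xs
  proof (induction xs)
    case (Cons x xs)
    have "[:x, 1:] = smult (- 1) ([:- x, 1:] \<circ>\<^sub>p [:0, -1:])"
      by (simp add: pcompose_pCons)
    then show ?case
      using Cons.IH by (simp add: pcompose_mult del: mult_pCons_left mult_pCons_right)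
  qed (simp add: pcompose_1)
  from this[of ys] have "root_poly (map uminus ys) = root_poly ys"
    by (simp add: assms(2) even_pcompose)
  then have "mset (rev (map uminus ys)) = mset ys"
    by (simp add: root_poly_eq_iff)
  moreover have "sorted (rev (map uminus ys))"
    using assms(1) by (simp add: sorted_wrt_rev sorted_wrt_map)
  ultimately have rev: "rev (map uminus ys) = ys"
    using assms(1) by (metis properties_for_sort)
  have "map uminus (rev (drop n ys)) = take n (rev (map uminus ys))"
    by (simp add: take_rev take_map rev_map drop_map assms(2))
  then show ?thesis
    using rev by simp
qed

text \<open>\<open>poly_zeros\<close> ignores multiplicity, so the length hypothesis says that all
  roots are real and simple. Two monic polynomials of this degree with these common roots have a
  difference of lower degree with too many roots.\<close>

lemma root_poly_poly_zeros:
  assumes "lead_coeff p = 1" "length (poly_zeros p) = degree p"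
  shows "root_poly (poly_zeros p) = p"
proof -
  have fin: "finite {x. poly p x = 0}"
    using assms(1) by (intro poly_roots_finite) auto
  have "set (poly_zeros p) = {x. poly p x = 0}" "distinct (poly_zeros p)"
    using fin by (simp_all add: poly_zeros_def)
  then have "poly (root_poly (poly_zeros p)) x = 0" if "poly p x = 0" for x
    using that proots_root_poly[of "poly_zeros p"]
    by (metis mem_Collect_eq root_poly_nonzero set_count_proots set_mset_mset)
  show ?thesis
  proof (rule ccontr)
    let ?d = "root_poly (poly_zeros p) - p"
    assume "root_poly (poly_zeros p) \<noteq> p"
    then have d: "?d \<noteq> 0" by simp
    have "{x. poly p x = 0} \<subseteq> {x. poly ?d x = 0}"
      using \<open>\<And>x. poly p x = 0 \<Longrightarrow> poly (root_poly (poly_zeros p)) x = 0\<close> by auto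
    then have "card {x. poly p x = 0} \<le> card {x. poly ?d x = 0}"
      by (rule card_mono[OF poly_roots_finite[OF d]])
    then have "degree p \<le> card {x. poly ?d x = 0}"
      using assms(2) unfolding poly_zeros_def by simp
    also have "\<dots> \<le> degree ?d"
      using d by (rule card_poly_roots_bound)
    finally have "degree p \<le> degree ?d" .
    moreover have "degree ?d \<le> degree p"
      using assms(2) by (intro degree_diff_le) auto
    ultimately have "lead_coeff ?d = coeff (root_poly (poly_zeros p)) (length (poly_zeros p)) - lead_coeff p"
      using assms(2) by simp
    also have "\<dots> = 0"
      using assms(1) lead_coeff_root_poly[of "poly_zeros p"] by simp
    finally show False using d by (simp only: leading_coeff_0_iff)
  qed
qed

subsection \<open>Hermite coefficients and the Laguerre limiting process\<close>

text \<open>With degree \<open>n + 2 = j + 2 * m\<close>, the two terms of the recurrence contribute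
  the shares \<open>j / (n + 2)\<close> and \<open>2 * m / (n + 2)\<close> of the claimed
  coefficient.\<close>

lemma coeff_hermite:
  "coeff (hermite n) j = (if j \<le> n \<and> even (n - j)
     then (- 1) ^ ((n - j) div 2) * fact n / (fact ((n - j) div 2) * fact j * 2 ^ ((n - j) div 2))
     else 0)"
proof (induction n arbitrary: j rule: hermite.induct)
  case (3 n)
  note IH = "3.IH"
  have rec: "coeff (hermite (Suc (Suc n))) j =
      (case j of 0 \<Rightarrow> 0 | Suc i \<Rightarrow> coeff (hermite (Suc n)) i) - real (Suc n) * coeff (hermite n) j"
    by (simp add: coeff_pCons)
  consider "j > Suc (Suc n)" | "odd (Suc (Suc n) - j)" | m where "Suc (Suc n) = j + 2 * m"
    by (metis evenE le_add_diff_inverse not_le)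
  then show ?case
  proof cases
    case 1
    then show ?thesis unfolding rec by (auto simp: IH split: nat.splits)
  next
    case 2
    then have "\<not> (j \<le> n \<and> even (n - j))"
      by (auto simp: Suc_diff_le)
    moreover have "\<not> (i \<le> Suc n \<and> even (Suc n - i))" if "j = Suc i" for i
      using 2 that by auto
    ultimately show ?thesis
      using 2 unfolding rec by (auto simp: IH split: nat.splits)
  next
    case 3
    let ?c = "\<lambda>n j m. (- 1) ^ m * fact n / (fact m * fact j * 2 ^ m) :: real"
    have A: "coeff (hermite n) j = (if m = 0 then 0 else ?c n j (m - 1))"
    proof (cases m)
      case (Suc m')
      then have "n = j + 2 * m'" using 3 by simp
      then show ?thesis using Suc by (subst IH) simp
    qed (use 3 in \<open>simp add: IH\<close>)
    have B: "(case j of 0 \<Rightarrow> 0 | Suc i \<Rightarrow> coeff (hermite (Suc n)) i) = (real j / real (Suc (Suc n))) * ?c (Suc (Suc n)) j m"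
    proof (cases j)
      case (Suc i)
      then have "Suc n = i + 2 * m" using 3 by simp
      then show ?thesis using Suc by (subst IH) (simp add: divide_simps)
    qed simp
    have "?c (Suc (Suc n)) j m = coeff (hermite (Suc (Suc n))) j"
      unfolding rec A B
    proof (cases m)
      case (Suc m')
      have "real (Suc (Suc n)) = real j + 2 * (real m' + 1)"
        using 3 Suc by (metis of_nat_Suc of_nat_add of_nat_mult of_nat_numeral add.commute)
      then show "?c (Suc (Suc n)) j m = real j / real (Suc (Suc n)) * ?c (Suc (Suc n)) j m
          - real (Suc n) * (if m = 0 then 0 else ?c n j (m - 1))"
        using Suc by (simp add: divide_simps) (simp add: algebra_simps)
    qed (use 3 in auto)
    then show ?thesis using 3 by simp
  qed
qed (auto simp: coeff_pCons split: nat.splits)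

lemma degree_hermite: "degree (hermite n) = n"
  by (intro antisym degree_le le_degree) (auto simp: coeff_hermite)

lemma lead_coeff_hermite: "lead_coeff (hermite n) = 1"
  by (simp add: degree_hermite coeff_hermite)

text \<open>Turns the factorials of even numbers from the Hermite side into binomials with
  half-integer upper argument. Raising \<open>j\<close> by one multiplies both sides by
  \<open>(m + j + 1) * (m + j + 1/2) / (j + 1)\<close>.\<close>

lemma fact_double_quotient:
  "fact (2 * (m + j)) / (fact (2 * m) * 4 ^ j * fact j) =
   fact (m + j) / fact m * ((real (m + j) - 1 / 2) gchoose j)"
proof (induction j)
  case (Suc j)
  have "fact (2 * (m + Suc j)) / (fact (2 * m) * 4 ^ Suc j * fact (Suc j)) =
      (real m + real j + 1) * ((real m + real j + 1 / 2) / (real j + 1)) *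
      (fact (2 * (m + j)) / (fact (2 * m) * 4 ^ j * fact j) :: real)"
    by (simp add: divide_simps) (simp add: algebra_simps)
  also have "\<dots> = fact (m + Suc j) / fact m *
      (((real (m + j) - 1 / 2) gchoose j) * ((real (m + j) - 1 / 2 + 1) / real (Suc j)))"
    unfolding Suc.IH by (simp add: field_simps)
  also have "((real (m + j) - 1 / 2) gchoose j) * ((real (m + j) - 1 / 2 + 1) / real (Suc j))
      = (real (m + Suc j) - 1 / 2) gchoose Suc j"
    by (subst gbinomial_rec[symmetric]) (simp add: algebra_simps)
  finally show ?case .
qed simp

text \<open>Solves the iterated integrals: in each round, integration supplies
  \<open>t / (k - s + 1)\<close>, the first prefactor extends the quotient of factorials, and the
  second one extends the binomial.\<close>

lemma laguerre_coeff_closed_form: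
  assumes "k \<le> length a" "t \<ge> 0"
  shows "laguerre_coeff \<alpha> a k t = (\<Sum>s\<le>k. elem_sym s a * t ^ (k - s) *
    (fact (length a - s) / fact (length a - k)) * ((\<alpha> + real (length a) - real s - 1) gchoose (k - s)))"
  using assms
proof (induction k arbitrary: t)
  case 0
  then show ?case by simp
next
  case (Suc k)
  let ?n = "length a"
  define c where "c s = elem_sym s a * (fact (?n - s) / fact (?n - k)) * ((\<alpha> + real ?n - real s - 1) gchoose (k - s))" for s
  have "((\<lambda>u. c s * u ^ (k - s)) has_integral c s * (t ^ Suc (k - s) / Suc (k - s))) {0..t}" for s
  proof -
    have "((\<lambda>u. u ^ (k - s)) has_integral t ^ Suc (k - s) / Suc (k - s) - 0 ^ Suc (k - s) / Suc (k - s)) {0..t}"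
      using Suc.prems by (intro fundamental_theorem_of_calculus)
        (auto intro!: derivative_eq_intros simp flip: has_real_derivative_iff_has_vector_derivative simp del: power_Suc)
    then show ?thesis
      by (intro has_integral_mult_right) simp
  qed
  then have "((\<lambda>u. \<Sum>s\<le>k. c s * u ^ (k - s)) has_integral (\<Sum>s\<le>k. c s * (t ^ Suc (k - s) / Suc (k - s)))) {0..t}"
    by (intro has_integral_sum finite_atMost)
  moreover have "laguerre_coeff \<alpha> a k u = (\<Sum>s\<le>k. c s * u ^ (k - s))" if "u \<in> {0..t}" for u
    using that Suc.prems Suc.IH[of u] by (simp add: c_def mult_ac)
  ultimately have int: "integral {0..t} (laguerre_coeff \<alpha> a k) = (\<Sum>s\<le>k. c s * (t ^ Suc (k - s) / Suc (k - s)))"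
    by (metis (no_types, lifting) has_integral_cong integral_unique)
  have "(real ?n - real (Suc k) + 1) * (real ?n - real (Suc k) + \<alpha>) * (c s * (t ^ Suc (k - s) / Suc (k - s))) =
      elem_sym s a * t ^ (Suc k - s) * (fact (?n - s) / fact (?n - Suc k)) *
        ((\<alpha> + real ?n - real s - 1) gchoose (Suc k - s))" if "s \<le> k" for s
  proof -
    have 1: "(real ?n - real (Suc k) + 1) / fact (?n - k) = 1 / fact (?n - Suc k)"
      using Suc.prems by (simp add: fact_reduce of_nat_diff field_simps)
    \<comment> \<open>With \<open>r = \<alpha> + n - s - 1\<close> and \<open>j = k - s\<close> the
      first factor is \<open>r - j\<close>, and
      \<open>(r - j) * (r gchoose j) = (j + 1) * (r gchoose (j + 1))\<close>.\<close>
    have 2: "(real ?n - real (Suc k) + \<alpha>) * ((\<alpha> + real ?n - real s - 1) gchoose (k - s)) =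
        real (Suc (k - s)) * ((\<alpha> + real ?n - real s - 1) gchoose (Suc (k - s)))"
      using gbinomial_mult_1[of "\<alpha> + real ?n - real s - 1" "k - s"] that
      by (simp add: of_nat_diff algebra_simps)
    have "(real ?n - real (Suc k) + 1) * (real ?n - real (Suc k) + \<alpha>) * (c s * (t ^ Suc (k - s) / Suc (k - s))) =
       elem_sym s a * t ^ Suc (k - s) * (fact (?n - s) * ((real ?n - real (Suc k) + 1) / fact (?n - k))) *
       (((real ?n - real (Suc k) + \<alpha>) * ((\<alpha> + real ?n - real s - 1) gchoose (k - s))) / Suc (k - s))"
      by (simp add: c_def)
    also have "\<dots> = elem_sym s a * t ^ Suc (k - s) * (fact (?n - s) / fact (?n - Suc k)) *
        ((\<alpha> + real ?n - real s - 1) gchoose (Suc (k - s)))"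
      unfolding 1 2 by simp
    finally show ?thesis using that by (simp add: Suc_diff_le)
  qed
  then have "(real ?n - real (Suc k) + 1) * (real ?n - real (Suc k) + \<alpha>) * integral {0..t} (laguerre_coeff \<alpha> a k) =
     (\<Sum>s\<le>k. elem_sym s a * t ^ (Suc k - s) * (fact (?n - s) / fact (?n - Suc k)) *
        ((\<alpha> + real ?n - real s - 1) gchoose (Suc k - s)))"
    unfolding int sum_distrib_left by (intro sum.cong) auto
  \<comment> \<open>The remaining summand, at \<open>s = Suc k\<close>, is the initial value
    \<open>elem_sym (Suc k) a\<close>.\<close>
  then show ?case
    by simp
qed

subsection \<open>Laguerre polynomials\<close>

text \<open>Euler's integral; passing from the closed to the open half-line removes a single
  point.\<close>

lemma powr_exp_has_integral_Gamma:
  fixes \<alpha> :: real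
  assumes "\<alpha> > 0"
  shows "((\<lambda>x. x powr (\<alpha> - 1) * exp (- x)) has_integral Gamma \<alpha>) {0<..}"
proof (rule iffD1[OF has_integral_spike_set_eq])
  show "((\<lambda>x. x powr (\<alpha> - 1) * exp (- x)) has_integral Gamma \<alpha>) {0..}"
    using Gamma_integral_real[OF assms] by (simp add: exp_minus divide_inverse)
  show "negligible {x \<in> {0..} - {0<..}. x powr (\<alpha> - 1) * exp (- x) \<noteq> (0::real)}"
    by (rule negligible_subset[of "{0}"]) auto
  show "negligible {x \<in> {0<..} - {0..}. x powr (\<alpha> - 1) * exp (- x) \<noteq> (0::real)}"
    by (rule negligible_subset[of "{}"]) auto
qed

lemma poly_pCons_times_powr_exp:
  assumes "x > (0::real)"
  shows "poly (pCons c p) x * (x powr (\<alpha> - 1) * exp (- x)) =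
    c * (x powr (\<alpha> - 1) * exp (- x)) + poly p x * (x powr (\<alpha> + 1 - 1) * exp (- x))"
proof -
  have "x powr (\<alpha> + 1 - 1) = x * x powr (\<alpha> - 1)"
    using assms powr_add[of x 1 "\<alpha> - 1"] by simp
  then show ?thesis
    by (simp add: algebra_simps)
qed

text \<open>Multiplying the polynomial by \<open>x\<close> amounts to raising \<alpha> by one, so
  the induction on \<open>p\<close> lets \<alpha> vary and Euler's integral handles each
  coefficient.\<close>

lemma poly_powr_exp_integrable:
  fixes \<alpha> :: real
  assumes "\<alpha> > 0"
  shows "(\<lambda>x. poly p x * (x powr (\<alpha> - 1) * exp (- x))) integrable_on {0<..}"
  using assms
proof (induction p arbitrary: \<alpha>)
  case (pCons c p)
  have "(\<lambda>x. c * (x powr (\<alpha> - 1) * exp (- x)) + poly p x * (x powr (\<alpha> + 1 - 1) * exp (- x)))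
      integrable_on {0<..}"
    using pCons.prems powr_exp_has_integral_Gamma[of \<alpha>]
    by (intro integrable_add pCons.IH integrable_on_mult_right has_integral_integrable) auto
  then show ?case
    by (rule integrable_eq) (subst poly_pCons_times_powr_exp; simp)
qed (simp add: integrable_0)

section \<open>The Laguerre weight as a linear functional on polynomials\<close>

definition laguerre_functional :: "real \<Rightarrow> real poly \<Rightarrow> real" where
  "laguerre_functional \<alpha> p = integral {0<..} (\<lambda>x. poly p x * (x powr (\<alpha> - 1) * exp (- x)))"

context
  fixes \<alpha> :: real
  assumes pos: "\<alpha> > 0"
begin

lemma laguerre_functional_add:
  "laguerre_functional \<alpha> (p + q) = laguerre_functional \<alpha> p + laguerre_functional \<alpha> q"
  unfolding laguerre_functional_def
  by (simp add: distrib_right integral_add poly_powr_exp_integrable pos)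

lemma laguerre_functional_diff:
  "laguerre_functional \<alpha> (p - q) = laguerre_functional \<alpha> p - laguerre_functional \<alpha> q"
  unfolding laguerre_functional_def
  by (simp add: left_diff_distrib integral_diff poly_powr_exp_integrable pos)

lemma laguerre_functional_smult:
  "laguerre_functional \<alpha> (smult c p) = c * laguerre_functional \<alpha> p"
  unfolding laguerre_functional_def by (simp add: mult.assoc)

lemma laguerre_functional_0: "laguerre_functional \<alpha> 0 = 0"
  by (simp add: laguerre_functional_def)

lemma laguerre_functional_pCons:
  "laguerre_functional \<alpha> (pCons c p) = c * Gamma \<alpha> + laguerre_functional (\<alpha> + 1) p"
proof -
  have "laguerre_functional \<alpha> (pCons c p) = integral {0<..}
      (\<lambda>x. c * (x powr (\<alpha> - 1) * exp (- x)) + poly p x * (x powr (\<alpha> + 1 - 1) * exp (- x)))"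
    unfolding laguerre_functional_def by (intro integral_cong poly_pCons_times_powr_exp) simp
  also have "\<dots> = c * Gamma \<alpha> + laguerre_functional (\<alpha> + 1) p"
    unfolding laguerre_functional_def
    using pos by (subst integral_add) (auto simp: integral_unique powr_exp_has_integral_Gamma
        intro!: integrable_on_mult_right has_integral_integrable[OF powr_exp_has_integral_Gamma]
          poly_powr_exp_integrable[of "\<alpha> + 1", simplified])
  finally show ?thesis .
qed

lemma laguerre_functional_has_integral:
  "((\<lambda>x. poly p x * (x powr (\<alpha> - 1) * exp (- x))) has_integral laguerre_functional \<alpha> p) {0<..}"
  unfolding laguerre_functional_def
  by (intro integrable_integral poly_powr_exp_integrable pos)

text \<open>The integrand is nonnegative, so its integral over \<open>{1..2}\<close> vanishes too.
  There it is continuous, away from a possible singularity of the weight at \<open>0\<close>, which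
  forces \<open>p\<close> to vanish at infinitely many points.\<close>

lemma laguerre_functional_square_eq_0:
  assumes "laguerre_functional \<alpha> (p * p) = 0"
  shows "p = 0"
proof (rule ccontr)
  assume "p \<noteq> 0"
  let ?f = "\<lambda>x. poly (p * p) x * (x powr (\<alpha> - 1) * exp (- x))"
  have int: "?f integrable_on {1..2}"
    by (intro integrable_continuous_interval continuous_intros) auto
  have "integral {1..2} ?f \<le> integral {0<..} ?f"
    by (intro integral_subset_le int poly_powr_exp_integrable pos) auto
  moreover have "0 \<le> integral {1..2} ?f"
    by (intro integral_nonneg int) auto
  ultimately have "(?f has_integral 0) (cbox 1 2)"
    using assms integrable_integral[OF int] by (simp add: laguerre_functional_def)
  moreover have "continuous_on (cbox 1 2) ?f"
    by (auto intro!: continuous_intros)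
  ultimately have "?f x = 0" if "x \<in> {1..2}" for x
    using that by (intro has_integral_0_cbox_imp_0[of 1 2 ?f]) auto
  then have "{1..2} \<subseteq> {x. poly p x = 0}"
    by force
  moreover have "infinite {1..2::real}"
    by simp
  ultimately show False
    using \<open>p \<noteq> 0\<close> poly_roots_finite finite_subset by blast
qed

end

text \<open>Integration by parts, \<open>d (x\<^sup>\<alpha> e\<^bsup>-x\<^esup> f) = x\<^bsup>\<alpha>-1\<^esup> e\<^bsup>-x\<^esup> ((\<alpha> - x) f + x f') dx\<close>, in the guise of
  \<open>\<Gamma>(\<alpha> + 1) = \<alpha> \<Gamma>(\<alpha>)\<close>.\<close>

lemma laguerre_functional_by_parts:
  assumes "\<alpha> > 0"
  shows "laguerre_functional \<alpha> ([:- \<alpha>, 1:] * f) = laguerre_functional \<alpha> (pCons 0 (pderiv f))"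
  using assms
proof (induction f arbitrary: \<alpha>)
  case (pCons c g)
  have G: "Gamma (\<alpha> + 1) = \<alpha> * Gamma \<alpha>"
    using pCons.prems by (intro Gamma_plus1) (auto elim!: nonpos_Ints_cases)
  \<comment> \<open>Splits so that the part with \<open>g\<close> has the form of the induction
    hypothesis at \<open>\<alpha> + 1\<close>, while the part with \<open>c\<close> contributes
    \<open>c * (Gamma (\<alpha> + 1) - \<alpha> * Gamma \<alpha>) = 0\<close>.\<close>
  have "[:- \<alpha>, 1:] * pCons c g = pCons 0 ([:- (\<alpha> + 1), 1:] * g + g) + smult c [:- \<alpha>, 1:]"
    by (simp add: fun_eq_iff algebra_simps flip: poly_eq_poly_eq_iff)
  moreover have "laguerre_functional \<alpha> (smult c [:- \<alpha>, 1:]) = 0"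
    using pCons.prems by (simp add: laguerre_functional_pCons laguerre_functional_0 G)
  ultimately have "laguerre_functional \<alpha> ([:- \<alpha>, 1:] * pCons c g) =
      laguerre_functional (\<alpha> + 1) ([:- (\<alpha> + 1), 1:] * g) + laguerre_functional (\<alpha> + 1) g"
    using pCons.prems
    by (simp add: laguerre_functional_add laguerre_functional_pCons del: mult_pCons_left)
  also have "\<dots> = laguerre_functional \<alpha> (pCons 0 (pderiv (pCons c g)))"
    using pCons.prems pCons.IH[of "\<alpha> + 1"]
    by (simp add: pderiv_pCons laguerre_functional_pCons[of \<alpha>]
        laguerre_functional_add[of "\<alpha> + 1"] del: mult_pCons_left)
  finally show ?case .
qed simp

text \<open>Differentiating \<open>x\<^sup>\<alpha> e\<^bsup>-x\<^esup> L\<close>, with \<open>L\<close> of degree \<open>n\<close> and parameter \<open>\<alpha> + 1\<close>, raises the degree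
  and lowers the parameter. Degree, coefficients, orthogonality and zeros all follow by induction
  along this relation.\<close>

primrec laguerre_rec :: "nat \<Rightarrow> real \<Rightarrow> real poly" where
  "laguerre_rec 0 \<alpha> = 1"
| "laguerre_rec (Suc n) \<alpha> = [:- \<alpha>, 1:] * laguerre_rec n (\<alpha> + 1) - pCons 0 (pderiv (laguerre_rec n (\<alpha> + 1)))"

text \<open>Both terms of the recurrence carry the same Pochhammer symbol and sign, so their
  binomials add up by Pascal's rule.\<close>

lemma coeff_laguerre_rec:
  "coeff (laguerre_rec n \<alpha>) k = (- 1) ^ (n - k) * real (n choose k) * pochhammer (\<alpha> + real k) (n - k)"
proof (induction n arbitrary: \<alpha> k)
  case 0
  then show ?case by (cases k) auto
next
  case (Suc n)
  have rec: "coeff (laguerre_rec (Suc n) \<alpha>) k = (case k of 0 \<Rightarrow> 0 | Suc i \<Rightarrow> coeff (laguerre_rec n (\<alpha> + 1)) i)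
      - (\<alpha> + real k) * coeff (laguerre_rec n (\<alpha> + 1)) k"
    by (cases k) (simp_all add: coeff_pCons coeff_pderiv algebra_simps)
  show ?case
  proof (cases k)
    case 0
    then show ?thesis unfolding rec by (simp add: Suc.IH pochhammer_rec)
  next
    case (Suc i)
    show ?thesis
    proof (cases "i < n")
      case True
      then obtain m where n: "n = Suc (i + m)" by (metis less_imp_Suc_add)
      show ?thesis unfolding rec Suc.IH
        using Suc by (simp add: n pochhammer_rec algebra_simps)
    next
      case False
      then show ?thesis unfolding rec Suc.IH
        using Suc by (simp add: binomial_eq_0)
    qed
  qed
qed

lemma degree_laguerre_rec: "degree (laguerre_rec n \<alpha>) = n"
  by (intro antisym degree_le le_degree) (auto simp: coeff_laguerre_rec)

lemma lead_coeff_laguerre_rec: "lead_coeff (laguerre_rec n \<alpha>) = 1"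
  by (simp add: degree_laguerre_rec coeff_laguerre_rec)

text \<open>Integration by parts turns the pairing of \<open>f\<close> with degree
  \<open>n + 1\<close> at \<alpha> into the pairing of \<open>pderiv f\<close> with degree
  \<open>n\<close> at \<open>\<alpha> + 1\<close>.\<close>

lemma laguerre_rec_orthogonal:
  assumes "\<alpha> > 0" "degree f < n"
  shows "laguerre_functional \<alpha> (f * laguerre_rec n \<alpha>) = 0"
  using assms
proof (induction n arbitrary: \<alpha> f)
  case (Suc n)
  let ?q = "laguerre_rec n (\<alpha> + 1)"
  have "f * laguerre_rec (Suc n) \<alpha> = [:- \<alpha>, 1:] * (f * ?q) - pCons 0 (f * pderiv ?q)"
    by (simp add: algebra_simps)
  then have "laguerre_functional \<alpha> (f * laguerre_rec (Suc n) \<alpha>) =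
      laguerre_functional (\<alpha> + 1) (pderiv (f * ?q) - f * pderiv ?q)"
    using Suc.prems
    by (simp only: laguerre_functional_diff laguerre_functional_by_parts)
       (simp add: laguerre_functional_pCons laguerre_functional_diff)
  also have "pderiv (f * ?q) - f * pderiv ?q = pderiv f * ?q"
    by (simp add: pderiv_mult mult.commute)
  also have "laguerre_functional (\<alpha> + 1) (pderiv f * ?q) = 0"
  \<comment> \<open>For constant \<open>f\<close> the degree bound need not pass to the derivative
    (it fails at \<open>n = 0\<close>), but the derivative is zero.\<close>
  proof (cases "degree f = 0")
    case True
    then have "pderiv f = 0" by (simp add: pderiv_eq_0_iff)
    then show ?thesis by (simp add: laguerre_functional_def)
  next
    case False
    then show ?thesis
      using Suc.prems by (intro Suc.IH) (auto simp: degree_pderiv)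
  qed
  finally show ?case .
qed simp

section \<open>Existence and uniqueness of the monic orthogonal family\<close>

lemma is_monic_laguerre_rec:
  assumes "\<alpha> > 0"
  shows "is_monic_laguerre \<alpha> (\<lambda>n. laguerre_rec n \<alpha>)"
  unfolding is_monic_laguerre_def
proof (intro conjI allI impI)
  fix m n :: nat assume "m \<noteq> n"
  then have "laguerre_functional \<alpha> (laguerre_rec m \<alpha> * laguerre_rec n \<alpha>) = 0"
    using laguerre_rec_orthogonal[OF assms, of "laguerre_rec m \<alpha>" n]
      laguerre_rec_orthogonal[OF assms, of "laguerre_rec n \<alpha>" m]
    by (auto simp: degree_laguerre_rec mult.commute neq_iff)
  then show "((\<lambda>x. poly (laguerre_rec m \<alpha>) x * poly (laguerre_rec n \<alpha>) x *
      (x powr (\<alpha> - 1) * exp (- x))) has_integral 0) {0<..}"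
    using laguerre_functional_has_integral[OF assms, of "laguerre_rec m \<alpha> * laguerre_rec n \<alpha>"] by simp
qed (simp_all add: degree_laguerre_rec lead_coeff_laguerre_rec[unfolded degree_laguerre_rec])

text \<open>Subtracting the multiple of \<open>L (degree f)\<close> with the same leading term
  lowers the degree of \<open>f\<close>, so pairwise orthogonality extends to all polynomials of
  degree below \<open>n\<close>.\<close>

lemma is_monic_laguerre_orthogonal:
  assumes "\<alpha> > 0" "is_monic_laguerre \<alpha> L" "degree f < n"
  shows "laguerre_functional \<alpha> (f * L n) = 0"
  using assms(3)
proof (induction "degree f" arbitrary: f rule: less_induct)
  case less
  let ?m = "degree f"
  let ?g = "f - smult (lead_coeff f) (L ?m)"
  have L: "degree (L m) = m" "coeff (L m) m = 1" for m
    using assms(2) unfolding is_monic_laguerre_def by metis+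
  have orth: "laguerre_functional \<alpha> (L ?m * L n) = 0"
    using assms(2) less.prems unfolding is_monic_laguerre_def laguerre_functional_def poly_mult
    by (intro integral_unique) auto
  have "laguerre_functional \<alpha> (?g * L n) = 0"
  proof (cases "?g = 0")
    case True
    then show ?thesis by (simp add: laguerre_functional_def)
  next
    case False
    have "degree ?g \<le> ?m"
      by (intro degree_diff_le) (auto intro: order_trans[OF degree_smult_le] simp: L)
    moreover have "coeff ?g ?m = 0"
      by (simp add: L)
    ultimately have "degree ?g < ?m"
      using False by (metis le_neq_implies_less leading_coeff_0_iff)
    then show ?thesis
      using less.prems by (intro less.hyps) auto
  qed
  moreover have "f * L n = ?g * L n + smult (lead_coeff f) (L ?m * L n)"
    by (simp add: algebra_simps)
  ultimately show ?case
    using orth assms(1) by (simp only: laguerre_functional_add laguerre_functional_smult mult_zero_right add_0)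
qed

text \<open>Both being monic, the difference has degree below \<open>n\<close>. It is then
  orthogonal to \<open>L n\<close> and to \<open>K n\<close>, hence to itself.\<close>

lemma is_monic_laguerre_unique:
  assumes "\<alpha> > 0" "is_monic_laguerre \<alpha> L" "is_monic_laguerre \<alpha> K"
  shows "L = K"
proof
  fix n
  let ?d = "L n - K n"
  have L: "degree (L n) = n" "coeff (L n) n = 1" "degree (K n) = n" "coeff (K n) n = 1"
    using assms(2,3) unfolding is_monic_laguerre_def by metis+
  have "?d = 0"
  proof (rule ccontr)
    assume "?d \<noteq> 0"
    moreover have "degree ?d \<le> n" "coeff ?d n = 0"
      using L by (auto intro: degree_diff_le)
    ultimately have "degree ?d < n"
      by (metis le_neq_implies_less leading_coeff_0_iff)
    then have "laguerre_functional \<alpha> (?d * L n) = 0" "laguerre_functional \<alpha> (?d * K n) = 0"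
      using assms is_monic_laguerre_orthogonal by blast+
    then have "laguerre_functional \<alpha> (?d * ?d) = 0"
      using assms(1) by (simp only: right_diff_distrib[of ?d] laguerre_functional_diff diff_0_right)
    then show False
      using \<open>?d \<noteq> 0\<close> assms(1) laguerre_functional_square_eq_0 by blast
  qed
  then show "L n = K n" by simp
qed

lemma laguerre_eq_rec:
  assumes "\<alpha> > 0"
  shows "laguerre \<alpha> n = laguerre_rec n \<alpha>"
proof -
  have "laguerre \<alpha> = (\<lambda>n. laguerre_rec n \<alpha>)"
    unfolding laguerre_def
    using assms is_monic_laguerre_rec is_monic_laguerre_unique by (intro the_equality) blast+
  then show ?thesis by simp
qed

section \<open>Real, simple and positive zeros through sign changes\<close>

lemma poly_alternating_roots:
  fixes p :: "real poly"
  assumes "\<And>i. i < m \<Longrightarrow> s i < s (Suc i)" "\<And>i. i < m \<Longrightarrow> poly p (s i) * poly p (s (Suc i)) < 0"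
  shows "s 0 \<le> s m \<and> (\<exists>U. finite U \<and> card U = m \<and> U \<subseteq> {x. poly p x = 0 \<and> s 0 < x \<and> x < s m})"
  using assms
proof (induction m)
  case (Suc m)
  obtain U where U: "s 0 \<le> s m" "finite U" "card U = m"
    "U \<subseteq> {x. poly p x = 0 \<and> s 0 < x \<and> x < s m}"
    using Suc.IH Suc.prems by force
  obtain u where u: "s m < u" "u < s (Suc m)" "poly p u = 0"
    using poly_IVT Suc.prems by blast
  \<comment> \<open>The earlier roots lie to the left of \<open>s m\<close>, the new one to its
    right.\<close>
  have "u \<notin> U" using U u by auto
  then have "card (insert u U) = Suc m" "finite (insert u U)"
    "insert u U \<subseteq> {x. poly p x = 0 \<and> s 0 < x \<and> x < s (Suc m)}"
    using U u by auto
  then show ?case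
    using U(1) u by (intro conjI exI[of _ "insert u U"]) auto
qed auto

text \<open>At a root only the product omitting its own factor survives, and its negative factors
  belong to the \<open>length rs - Suc j\<close> larger roots.\<close>

lemma sign_pderiv_root_poly:
  assumes "sorted_wrt (<) rs" "j < length rs"
  shows "(- 1) ^ (length rs - Suc j) * poly (pderiv (root_poly rs)) (rs ! j) > 0"
proof -
  let ?n = "length rs"
  have "poly (pderiv (root_poly rs)) (rs ! j) = (\<Sum>i<?n. \<Prod>k\<in>{..<?n} - {i}. rs ! j - rs ! k)"
    by (simp add: root_poly_def prod.list_conv_set_nth atLeast0LessThan pderiv_prod poly_sum poly_prod
        pderiv_pCons)
  also have "\<dots> = (\<Sum>i<?n. if i = j then \<Prod>k\<in>{..<?n} - {j}. rs ! j - rs ! k else 0)"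
    using assms(2) by (intro sum.cong) auto
  also have "\<dots> = (\<Prod>k\<in>{..<?n} - {j}. rs ! j - rs ! k)"
    using assms(2) by simp
  also have "{..<?n} - {j} = {..<j} \<union> {Suc j..<?n}"
    using assms(2) by auto
  also have "(\<Prod>k\<in>{..<j} \<union> {Suc j..<?n}. rs ! j - rs ! k) =
      (\<Prod>k<j. rs ! j - rs ! k) * (\<Prod>k\<in>{Suc j..<?n}. rs ! j - rs ! k)"
    by (rule prod.union_disjoint) auto
  also have "(\<Prod>k\<in>{Suc j..<?n}. rs ! j - rs ! k) =
      (- 1) ^ (?n - Suc j) * (\<Prod>k\<in>{Suc j..<?n}. rs ! k - rs ! j)"
    using prod_uminus[of "\<lambda>k. rs ! k - rs ! j" "{Suc j..<?n}"] by simp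
  finally have "(- 1) ^ (?n - Suc j) * poly (pderiv (root_poly rs)) (rs ! j) =
      (\<Prod>k<j. rs ! j - rs ! k) * (\<Prod>k\<in>{Suc j..<?n}. rs ! k - rs ! j)"
    by (simp flip: mult.assoc power_add)
  moreover have "(\<Prod>k<j. rs ! j - rs ! k) > 0" "(\<Prod>k\<in>{Suc j..<?n}. rs ! k - rs ! j) > 0"
    using assms by (auto intro!: prod_pos simp: sorted_wrt_nth_less)
  ultimately show ?thesis by simp
qed

text \<open>Interlacing: at a zero \<open>r\<close> of the polynomial \<open>q\<close> of degree
  \<open>n\<close> and parameter \<open>\<alpha> + 1\<close>, the next polynomial equals
  \<open>- r * q'(r)\<close>, and at \<open>0\<close> it equals
  \<open>- \<alpha> * q(0)\<close>.\<close>

lemma laguerre_rec_zeros: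
  assumes "\<alpha> > 0"
  shows "length (poly_zeros (laguerre_rec n \<alpha>)) = n \<and> (\<forall>x\<in>set (poly_zeros (laguerre_rec n \<alpha>)). x > 0)"
  using assms
proof (induction n arbitrary: \<alpha>)
  case 0
  then show ?case by (simp add: poly_zeros_def)
next
  case (Suc n)
  let ?q = "laguerre_rec n (\<alpha> + 1)" and ?p = "laguerre_rec (Suc n) \<alpha>"
  define rs where "rs = poly_zeros ?q"
  have rs: "length rs = n" "\<And>x. x \<in> set rs \<Longrightarrow> x > 0"
    using Suc.IH[of "\<alpha> + 1"] Suc.prems by (auto simp: rs_def)
  have sorted: "sorted_wrt (<) rs"
    by (simp add: rs_def poly_zeros_def strict_sorted_list_of_set)
  have q: "?q = root_poly rs"
    using rs root_poly_poly_zeros[of ?q] lead_coeff_laguerre_rec[of n "\<alpha> + 1"]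
    by (simp add: degree_laguerre_rec rs_def)
  have p: "poly ?p x = (x - \<alpha>) * poly (root_poly rs) x - x * poly (pderiv (root_poly rs)) x" for x
    unfolding laguerre_rec.simps q by (simp add: algebra_simps)
  have root: "poly (root_poly rs) (rs ! i) = 0" if "i < n" for i
    using that rs(1) by (metis mem_Collect_eq nth_mem proots_root_poly root_poly_nonzero
        set_count_proots set_mset_mset)
  \<comment> \<open>\<open>L\<^sub>n\<^sub>+\<^sub>1\<close> alternates in sign along \<open>0\<close>, the zeros of \<open>L\<^sub>n\<close> and a point \<open>b\<close> far to the right.\<close>
  obtain B where B: "\<And>x. x \<ge> B \<Longrightarrow> poly ?p x \<ge> lead_coeff ?p"
    using poly_pinfty_gt_lc[of ?p] lead_coeff_laguerre_rec[of "Suc n" \<alpha>] by (metis zero_less_one)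
  \<comment> \<open>The entry \<open>1\<close> keeps \<open>b\<close> positive even without zeros,
    and the shift by one puts \<open>b\<close> strictly beyond every zero.\<close>
  define b where "b = Max (insert B (insert 1 ((\<lambda>x. x + 1) ` set rs)))"
  have b: "b \<ge> B" "b > 0" "\<And>i. i < n \<Longrightarrow> rs ! i < b"
  proof -
    show "b \<ge> B" by (simp add: b_def)
    have "b \<ge> 1" unfolding b_def by (intro Max_ge) auto
    then show "b > 0" by simp
    fix i assume "i < n"
    then have "rs ! i + 1 \<le> b"
      unfolding b_def using rs(1) by (intro Max_ge) auto
    then show "rs ! i < b" by simp
  qed
  define s where "s i = (if i = 0 then 0 else if i \<le> n then rs ! (i - 1) else b)" for i
  have mono: "s i < s (Suc i)" if "i < Suc n" for i
  proof -
    consider "i = 0" "n = 0" | "i = 0" "n > 0" | "0 < i" "i < n" | "0 < i" "i = n"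
      using \<open>i < Suc n\<close> by linarith
    then show ?thesis
    proof cases
      case 3
      then show ?thesis using sorted rs(1) by (auto simp: s_def intro: sorted_wrt_nth_less)
    qed (use rs b in \<open>auto simp: s_def\<close>)
  qed
  \<comment> \<open>Signs are counted from the right, where the value at \<open>b\<close> is
    positive.\<close>
  have sign: "(- 1) ^ (Suc n - i) * poly ?p (s i) > 0" if i: "i \<le> Suc n" for i
  proof -
    consider "i = 0" | j where "i = Suc j" "j < n" | "i = Suc n"
      using i by (cases i) (auto simp: less_Suc_eq_le le_less)
    then show ?thesis
    proof cases
      case 1
      have "poly (root_poly xs) 0 = (- 1) ^ length xs * prod_list xs" for xs
        by (induction xs) auto
      moreover have "prod_list xs > 0" if "\<And>x. x \<in> set xs \<Longrightarrow> x > 0" for xs :: "real list"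
        using that by (induction xs) auto
      ultimately have "(- 1) ^ n * poly (root_poly rs) 0 > 0"
        using rs by (simp flip: power_add mult.assoc)
      then have "0 < \<alpha> * ((- 1) ^ n * poly (root_poly rs) 0)"
        using Suc.prems by simp
      then show ?thesis
        using 1 by (simp add: s_def p mult_ac del: laguerre_rec.simps)
    next
      case 2
      then have "0 < rs ! j * ((- 1) ^ (n - Suc j) * poly (pderiv (root_poly rs)) (rs ! j))"
        using sign_pderiv_root_poly[OF sorted, of j] rs by simp
      moreover have "(- 1) ^ (n - j) = - ((- 1) ^ (n - Suc j) :: real)"
        using 2 by (simp flip: Suc_diff_Suc)
      ultimately show ?thesis
        using 2 by (simp add: s_def p root mult_ac del: laguerre_rec.simps)
    next
      case 3
      then show ?thesis
        using B[of b] b lead_coeff_laguerre_rec[of "Suc n" \<alpha>]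
        by (simp add: s_def del: laguerre_rec.simps)
    qed
  qed
  have alt: "poly ?p (s i) * poly ?p (s (Suc i)) < 0" if "i < Suc n" for i
  proof -
    have "(- 1) ^ (n - i) * poly ?p (s i) < 0" "(- 1) ^ (n - i) * poly ?p (s (Suc i)) > 0"
      using sign[of i] sign[of "Suc i"] that by (simp_all add: Suc_diff_le del: laguerre_rec.simps)
    then show ?thesis
      by (cases "even (n - i)") (auto simp: mult_less_0_iff simp del: laguerre_rec.simps)
  qed
  obtain U where U: "finite U" "card U = Suc n" "U \<subseteq> {x. poly ?p x = 0 \<and> 0 < x}"
    using poly_alternating_roots[of "Suc n" s ?p] mono alt by (auto simp: s_def simp del: laguerre_rec.simps)
  let ?Z = "{x. poly ?p x = 0}"
  have nz: "?p \<noteq> 0"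
    using degree_laguerre_rec[of "Suc n" \<alpha>] by (auto simp del: laguerre_rec.simps)
  have "card ?Z \<le> Suc n"
    using card_poly_roots_bound[OF nz] by (simp only: degree_laguerre_rec)
  \<comment> \<open>The \<open>Suc n\<close> positive zeros found already reach the degree bound, so
    there are no others.\<close>
  then have "U = ?Z"
    using U poly_roots_finite[OF nz] by (intro card_seteq) auto
  then have "poly_zeros ?p = sorted_list_of_set U"
    by (simp only: poly_zeros_def)
  then show ?case
    using U by (simp del: laguerre_rec.simps) auto
qed

subsection \<open>The convolution\<close>

text \<open>The length hypothesis expresses that all zeros are real and simple; in the application
  it comes from the length condition inside \<open>is_finite_free_conv\<close>.\<close>

lemma elem_sym_hermite_zeros:
  assumes "length (poly_zeros (hermite n)) = n" "k \<le> n"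
  shows "elem_sym k (poly_zeros (hermite n)) =
    (if even k then (- 1) ^ (k div 2) * fact n / (fact (k div 2) * fact (n - k) * 2 ^ (k div 2)) else 0)"
proof -
  have "root_poly (poly_zeros (hermite n)) = hermite n"
    using assms(1) lead_coeff_hermite[of n]
    by (intro root_poly_poly_zeros) (simp_all add: degree_hermite)
  then show ?thesis
    using assms by (simp add: elem_sym_conv_coeff coeff_hermite)
qed

text \<open>The sign from Vieta cancels that of the coefficient, and the rising product from
  \<open>\<alpha> + n - k\<close> to \<open>\<alpha> + n - 1\<close> is \<open>fact k\<close> times
  the binomial.\<close>

lemma elem_sym_laguerre_zeros:
  assumes "\<alpha> > 0" "k \<le> n"
  shows "elem_sym k (poly_zeros (laguerre \<alpha> n)) =
    fact n / fact (n - k) * ((\<alpha> + real n - 1) gchoose k)"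
proof -
  have "root_poly (poly_zeros (laguerre_rec n \<alpha>)) = laguerre_rec n \<alpha>"
    using laguerre_rec_zeros[OF assms(1), of n] lead_coeff_laguerre_rec[of n \<alpha>]
    by (intro root_poly_poly_zeros) (simp_all add: degree_laguerre_rec)
  moreover have "\<alpha> + real n - 1 - real k + 1 = \<alpha> + real (n - k)"
    using assms(2) by simp
  moreover have "real (n choose (n - k)) = fact n / (fact k * fact (n - k))"
    using assms(2) by (simp add: binomial_fact)
  ultimately show ?thesis
    using assms laguerre_rec_zeros[OF assms(1), of n]
    by (simp add: laguerre_eq_rec elem_sym_conv_coeff coeff_laguerre_rec gbinomial_pochhammer'
        flip: mult.assoc power_add)
qed

lemma sum_even_index:
  fixes f :: "nat \<Rightarrow> 'a::comm_monoid_add"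
  assumes "\<And>i. odd i \<Longrightarrow> f i = 0"
  shows "(\<Sum>i\<le>2 * k. f i) = (\<Sum>i\<le>k. f (2 * i))"
  by (induction k) (simp_all add: assms)

section \<open>The tuple \<open>y(t)\<close> and the convolution with the Laguerre zeros\<close>

context
  fixes a y :: "real list" and n :: nat and t :: real
  assumes len: "length a = n" and nonneg: "\<forall>v\<in>set a. 0 \<le> v" and t: "t \<ge> 0"
    and conv: "is_finite_free_conv (2 * n)
      (map (\<lambda>v. - sqrt (2 * v)) (rev a) @ map (\<lambda>v. sqrt (2 * v)) a)
      (map (\<lambda>z. sqrt t * z) (poly_zeros (hermite (2 * n)))) y"
begin

text \<open>Both tuples are symmetric about \<open>0\<close>, so only even indices contribute. The
  factors \<open>fact (2 * n)\<close> and \<open>fact (2 * n - (k - i))\<close> cancel against the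
  Hermite coefficient.\<close>

lemma elem_sym_hermite_conv:
  assumes k: "k \<le> 2 * n"
  shows "elem_sym k y = (if even k then
    (\<Sum>i\<le>k div 2. fact (2 * n - 2 * i) / (fact (2 * n - k) * fact (k div 2 - i)) *
       ((- 1) ^ (k div 2) * 2 ^ i * elem_sym i a * t ^ (k div 2 - i) / 2 ^ (k div 2 - i))) else 0)"
proof -
  let ?as = "map (\<lambda>v. - sqrt (2 * v)) (rev a) @ map (\<lambda>v. sqrt (2 * v)) a"
  let ?zs = "map (\<lambda>z. sqrt t * z) (poly_zeros (hermite (2 * n)))"
  have zs: "length (poly_zeros (hermite (2 * n))) = 2 * n"
    using conv by (simp add: is_finite_free_conv_def)
  have as: "elem_sym i ?as = (if even i then (- 1) ^ (i div 2) * 2 ^ (i div 2) * elem_sym (i div 2) a else 0)"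
    if "i \<le> 2 * n" for i
  proof -
    have "?as = map uminus (rev (map (\<lambda>v. sqrt (2 * v)) a)) @ map (\<lambda>v. sqrt (2 * v)) a"
      by (simp add: rev_map)
    moreover have "map (\<lambda>v. v\<^sup>2) (map (\<lambda>v. sqrt (2 * v)) a) = map (\<lambda>v. 2 * v) a"
      using nonneg by simp
    ultimately show ?thesis
      using that elem_sym_symmetric[of i "map (\<lambda>v. sqrt (2 * v)) a"] len
      by (simp only: elem_sym_map_mult length_map) simp
  qed
  define f where "f i = fact (2 * n - i) * fact (2 * n - (k - i)) / (fact (2 * n) * fact (2 * n - k))
    * elem_sym i ?as * elem_sym (k - i) ?zs" for i
  have f: "f i = (if even i \<and> even k then fact (2 * n - i) / (fact (2 * n - k) * fact (k div 2 - i div 2)) *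
       ((- 1) ^ (k div 2) * 2 ^ (i div 2) * elem_sym (i div 2) a * t ^ (k div 2 - i div 2) / 2 ^ (k div 2 - i div 2))
       else 0)" if i: "i \<le> k" for i
  proof (cases "even i \<and> even k")
    case True
    then obtain p q where pq: "i = 2 * p" "k = 2 * p + 2 * q"
      by (metis dvd_def add_mult_distrib2 i le_Suc_ex even_add)
    have "sqrt t ^ (2 * q) = t ^ q"
      using t by (simp add: power_mult)
    then show ?thesis
      using i k zs
      by (simp add: f_def pq as elem_sym_map_mult elem_sym_hermite_zeros power_add)
        (simp add: mult_ac)
  next
    case False
    then have "odd i \<or> odd (k - i)" using i by auto
    then show ?thesis
      using False i k zs by (auto simp: f_def as elem_sym_map_mult elem_sym_hermite_zeros)
  qed
  \<comment> \<open>The convolution prescribes only \<open>k \<ge> 1\<close>; at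
    \<open>k = 0\<close> both sides are \<open>1\<close>.\<close>
  have e: "elem_sym k y = (\<Sum>i\<le>k. f i)"
  proof (cases "k = 0")
    case True
    then show ?thesis by (simp add: f_def)
  next
    case False
    then show ?thesis
      using conv k by (simp add: is_finite_free_conv_def f_def)
  qed
  show ?thesis
  proof (cases "even k")
    case True
    then obtain m where m: "k = 2 * m" by blast
    \<comment> \<open>The formula for \<open>f i\<close> holds only for \<open>i \<le> k\<close>;
      padding by zero makes every odd index vanish.\<close>
    define g where "g i = (if i \<le> k then f i else 0)" for i
    have "elem_sym k y = (\<Sum>i\<le>2 * m. g i)"
      unfolding e by (simp add: g_def m)
    also have "\<dots> = (\<Sum>i\<le>m. g (2 * i))"
      by (rule sum_even_index) (simp add: g_def f)
    also have "\<dots> = (\<Sum>i\<le>m. fact (2 * n - 2 * i) / (fact (2 * n - k) * fact (k div 2 - i)) *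
       ((- 1) ^ (k div 2) * 2 ^ i * elem_sym i a * t ^ (k div 2 - i) / 2 ^ (k div 2 - i)))"
      by (intro sum.cong) (simp_all add: g_def f m)
    finally show ?thesis
      using True m by simp
  qed (simp add: e f)
qed

text \<open>The vanishing odd terms make \<open>y\<close> symmetric, so its even terms are, up to
  sign, those of the squared upper half. The result is the closed form of
  \<open>laguerre_coeff\<close> with parameter \<open>1/2\<close>.\<close>

lemma elem_sym_half_square:
  assumes k: "k \<le> n"
  shows "elem_sym k (map (\<lambda>v. 1 / 2 * v\<^sup>2) (drop n y)) =
    (\<Sum>i\<le>k. elem_sym i a * t ^ (k - i) * (fact (n - i) / fact (n - k)) *
      ((real n - real i - 1 / 2) gchoose (k - i)))"
proof -
  have y: "sorted y" "length y = 2 * n"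
    using conv by (simp_all add: is_finite_free_conv_def)
  have "elem_sym (2 * k) y = (- 1) ^ k * elem_sym k (map (\<lambda>v. v\<^sup>2) (drop n y))"
    using sorted_symmetricI[OF y] elem_sym_symmetric[of "2 * k" "drop n y"] elem_sym_hermite_conv k y(2)
    by simp
  then have "elem_sym k (map (\<lambda>v. v\<^sup>2) (drop n y)) = (- 1) ^ k * elem_sym (2 * k) y"
    by (simp flip: mult.assoc power_add)
  then have "elem_sym k (map (\<lambda>v. 1 / 2 * v\<^sup>2) (drop n y)) = (1 / 2) ^ k * ((- 1) ^ k * elem_sym (2 * k) y)"
    using elem_sym_map_mult[of k "1 / 2" "map (\<lambda>v. v\<^sup>2) (drop n y)"] by (simp add: comp_def)
  also have "elem_sym (2 * k) y = (\<Sum>i\<le>k. fact (2 * n - 2 * i) / (fact (2 * n - 2 * k) * fact (k - i)) *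
       ((- 1) ^ k * 2 ^ i * elem_sym i a * t ^ (k - i) / 2 ^ (k - i)))"
    using elem_sym_hermite_conv[of "2 * k"] k by simp
  also have "(1 / 2) ^ k * ((- 1) ^ k * \<dots>) =
      (\<Sum>i\<le>k. elem_sym i a * t ^ (k - i) * (fact (n - i) / fact (n - k)) *
      ((real n - real i - 1 / 2) gchoose (k - i)))"
    unfolding sum_distrib_left
  proof (intro sum.cong refl)
    fix i assume "i \<in> {..k}"
    then obtain j where j: "k = i + j" by (metis atMost_iff le_Suc_ex)
    obtain m where m: "n = m + k" using k by (metis add.commute le_Suc_ex)
    have ij: "k - i = j" "2 * n - 2 * i = 2 * (m + j)" "2 * n - 2 * k = 2 * m"
        "n - i = m + j" "n - k = m" "real n - real i = real (m + j)"
      by (simp_all add: j m)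
    have sign: "(- 1) ^ k * (- 1) ^ k = (1 :: real)"
      by (simp flip: power_add)
    \<comment> \<open>The powers of two from the halving, from \<open>sqrt (2 * v)\<close> and from
      the Hermite coefficients combine to the \<open>4 ^ j\<close> of
      \<open>fact_double_quotient\<close>.\<close>
    have "(4::real) ^ j = 2 ^ j * 2 ^ j"
      by (simp flip: power_mult_distrib)
    then have pow: "(1 / 2) ^ k * 2 ^ i / 2 ^ j = 1 / (4::real) ^ j"
      by (simp add: j power_add power_one_over)
    have "(1 / 2) ^ k * ((- 1) ^ k * (fact (2 * (m + j)) / (fact (2 * m) * fact j) *
       ((- 1) ^ k * 2 ^ i * elem_sym i a * t ^ j / 2 ^ j))) =
       ((- 1) ^ k * (- 1) ^ k) * ((1 / 2) ^ k * 2 ^ i / 2 ^ j) *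
       (elem_sym i a * t ^ j * (fact (2 * (m + j)) / (fact (2 * m) * fact j)))"
      by (simp only: times_divide_eq_left times_divide_eq_right divide_divide_eq_left mult_ac)
    also have "\<dots> = elem_sym i a * t ^ j * (fact (2 * (m + j)) / (fact (2 * m) * 4 ^ j * fact j))"
      unfolding sign pow by simp
    also have "\<dots> = elem_sym i a * t ^ j * (fact (m + j) / fact m) * ((real (m + j) - 1 / 2) gchoose j)"
      unfolding fact_double_quotient by (simp only: mult.assoc)
    finally show "(1 / 2) ^ k * ((- 1) ^ k * (fact (2 * n - 2 * i) / (fact (2 * n - 2 * k) * fact (k - i)) *
       ((- 1) ^ k * 2 ^ i * elem_sym i a * t ^ (k - i) / 2 ^ (k - i)))) =
       elem_sym i a * t ^ (k - i) * (fact (n - i) / fact (n - k)) *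
      ((real n - real i - 1 / 2) gchoose (k - i))"
      unfolding ij .
  qed
  finally show ?thesis .
qed

lemma laguerre_conv_coeff:
  assumes k: "k \<le> n" and \<alpha>: "\<alpha> > real n - 1 / 2"
  shows "(\<Sum>i\<le>k. (fact (n - i) * fact (n - (k - i))) / (fact n * fact (n - k)) *
      elem_sym i (map (\<lambda>v. 1 / 2 * v\<^sup>2) (drop n y)) *
      elem_sym (k - i) (map (\<lambda>z. t * z) (poly_zeros (laguerre (\<alpha> - real n + 1 / 2) n)))) =
    laguerre_coeff \<alpha> a k t"
proof -
  let ?b = "\<lambda>s. elem_sym s a * t ^ (k - s) * (fact (n - s) / fact (n - k))"
  let ?g = "\<lambda>s i. ((real n - real s - 1 / 2) gchoose (i - s)) * ((\<alpha> - 1 / 2) gchoose (k - i))"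
  have "(\<Sum>i\<le>k. (fact (n - i) * fact (n - (k - i))) / (fact n * fact (n - k)) *
      elem_sym i (map (\<lambda>v. 1 / 2 * v\<^sup>2) (drop n y)) *
      elem_sym (k - i) (map (\<lambda>z. t * z) (poly_zeros (laguerre (\<alpha> - real n + 1 / 2) n)))) =
      (\<Sum>i\<le>k. \<Sum>s\<le>i. ?b s * ?g s i)"
  proof (intro sum.cong refl)
    fix i assume "i \<in> {..k}"
    then have i: "i \<le> k" by simp
    have z: "elem_sym (k - i) (map (\<lambda>z. t * z) (poly_zeros (laguerre (\<alpha> - real n + 1 / 2) n)))
        = t ^ (k - i) * (fact n / fact (n - (k - i)) * ((\<alpha> - 1 / 2) gchoose (k - i)))"
      using k \<alpha> i by (subst elem_sym_map_mult, subst elem_sym_laguerre_zeros) auto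
    \<comment> \<open>The weight \<open>fact (n - i)\<close> of the convolution cancels the
      denominator in \<open>elem_sym_half_square\<close>, so that \<open>?b s\<close> no longer
      depends on \<open>i\<close>.\<close>
    have "?b s * ?g s i = (fact (n - i) / fact (n - k) * t ^ (k - i) * ((\<alpha> - 1 / 2) gchoose (k - i))) *
        (elem_sym s a * t ^ (i - s) * (fact (n - s) / fact (n - i)) *
        ((real n - real s - 1 / 2) gchoose (i - s)))" if "s \<le> i" for s
    proof -
      have "t ^ (k - s) = t ^ (k - i) * t ^ (i - s)"
        using that i by (simp flip: power_add)
      then show ?thesis by simp
    qed
    then have "(\<Sum>s\<le>i. ?b s * ?g s i) =
        (fact (n - i) / fact (n - k) * t ^ (k - i) * ((\<alpha> - 1 / 2) gchoose (k - i))) *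
        elem_sym i (map (\<lambda>v. 1 / 2 * v\<^sup>2) (drop n y))"
      using k i unfolding elem_sym_half_square[OF order_trans[OF i k]] sum_distrib_left
      by (intro sum.cong) auto
    then show "(fact (n - i) * fact (n - (k - i))) / (fact n * fact (n - k)) *
      elem_sym i (map (\<lambda>v. 1 / 2 * v\<^sup>2) (drop n y)) *
      elem_sym (k - i) (map (\<lambda>z. t * z) (poly_zeros (laguerre (\<alpha> - real n + 1 / 2) n))) =
      (\<Sum>s\<le>i. ?b s * ?g s i)"
      unfolding z by simp
  qed
  \<comment> \<open>Interchanges the summations over the triangle \<open>s \<le> i \<le> k\<close>;
    the inner sum becomes Chu-Vandermonde after the shift \<open>i = j + s\<close>.\<close>
  also have "\<dots> = (\<Sum>s\<le>k. \<Sum>i\<in>{s..k}. ?b s * ?g s i)"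
    unfolding sum.Sigma[OF finite_atMost ballI[OF finite_atMost]]
      sum.Sigma[OF finite_atMost ballI[OF finite_atLeastAtMost]]
    by (rule sum.reindex_bij_witness[of _ "\<lambda>(s, i). (i, s)" "\<lambda>(i, s). (s, i)"]) auto
  also have "\<dots> = (\<Sum>s\<le>k. ?b s * ((\<alpha> + real n - real s - 1) gchoose (k - s)))"
  proof (intro sum.cong refl)
    fix s assume "s \<in> {..k}"
    then have s: "s \<le> k" by simp
    have "(\<Sum>i\<in>{s..k}. ?g s i) = (\<Sum>j\<in>{0..k - s}. ((real n - real s - 1 / 2) gchoose j) *
        ((\<alpha> - 1 / 2) gchoose (k - s - j)))"
      using s by (intro sum.reindex_bij_witness[of _ "\<lambda>j. j + s" "\<lambda>i. i - s"]) auto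
    also have "\<dots> = (\<alpha> + real n - real s - 1) gchoose (k - s)"
      unfolding gbinomial_Vandermonde by (simp add: algebra_simps)
    finally show "(\<Sum>i\<in>{s..k}. ?b s * ?g s i) = ?b s * ((\<alpha> + real n - real s - 1) gchoose (k - s))"
      by (simp only: sum_distrib_left[symmetric])
  qed
  also have "\<dots> = laguerre_coeff \<alpha> a k t"
    using k t len by (simp add: laguerre_coeff_closed_form)
  finally show ?thesis .
qed

end

theorem theorem5p7:
  fixes N :: nat and \<alpha> :: real and a :: "real list" and x y :: "real \<Rightarrow> real list"
  assumes "N \<ge> 2"
    and "\<alpha> > real N - 1/2"
    and "length a = N" and "sorted a" and "\<forall>v\<in>set a. 0 \<le> v"
    and "\<forall>t\<ge>0. is_finite_free_conv (2 * N)
           (map (\<lambda>v. - sqrt (2 * v)) (rev a) @ map (\<lambda>v. sqrt (2 * v)) a)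
           (map (\<lambda>z. sqrt t * z) (poly_zeros (hermite (2 * N))))
           (y t)"
    and "is_laguerre_limiting \<alpha> a x"
  shows "\<forall>t\<ge>0. is_finite_free_conv N
           (map (\<lambda>v. 1/2 * v^2) (drop N (y t)))
           (map (\<lambda>z. t * z) (poly_zeros (laguerre (\<alpha> - real N + 1/2) N)))
           (x t)"
proof (intro allI impI)
  fix t :: real assume t: "t \<ge> 0"
  have conv: "is_finite_free_conv (2 * N)
      (map (\<lambda>v. - sqrt (2 * v)) (rev a) @ map (\<lambda>v. sqrt (2 * v)) a)
      (map (\<lambda>z. sqrt t * z) (poly_zeros (hermite (2 * N)))) (y t)"
    using assms(6) t by blast
  then have "length (y t) = 2 * N"
    by (simp add: is_finite_free_conv_def)
  \<comment> \<open>The bound \<open>\<alpha> > N - 1/2\<close> makes the Laguerre parameter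
    positive, so the list of zeros has full length.\<close>
  moreover have "length (poly_zeros (laguerre (\<alpha> - real N + 1/2) N)) = N"
    using assms(2) laguerre_rec_zeros[of "\<alpha> - real N + 1/2" N] by (simp add: laguerre_eq_rec)
  moreover have "length (x t) = N" "sorted (x t)"
      "\<And>k. k \<in> {1..N} \<Longrightarrow> elem_sym k (x t) = laguerre_coeff \<alpha> a k t"
    using assms(3,7) t by (auto simp: is_laguerre_limiting_def)
  ultimately show "is_finite_free_conv N
           (map (\<lambda>v. 1/2 * v^2) (drop N (y t)))
           (map (\<lambda>z. t * z) (poly_zeros (laguerre (\<alpha> - real N + 1/2) N)))
           (x t)"
    unfolding is_finite_free_conv_def
    using laguerre_conv_coeff[OF assms(3,5) t conv _ assms(2)] by auto
qed

end
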